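(* There exist an amenable metric space $X$ of bounded geometry and an element $s\in M(X)$ such that $s^*s=\mathbf 1$ but $ss^*\neq\mathbf 1$.
   Context: A metric space $(X,d_X)$ has bounded geometry if for every $r>0$ the cardinalities of the balls of radius $r$ in $X$ are bounded uniformly in the center. Such a space is amenable if it has a Følner sequence: a sequence of non-empty finite subsets $F_n\subset X$ such that $|N_r(F_n)\setminus F_n|/|F_n|\to 0$ as $n\to\infty$ for every $r>0$, where $N_r(A)$ denotes the $r$-neighborhood of $A$. The inverse semigroup $M(X)$: the double of $X$ is $X\sqcup X'$, where $X=X\times\{0\}$ and $X'=X\times\{1\}$ are two copies of $X$; write $x=(x,0)$ and $x'=(x,1)$. Let $\mathcal M(X)$ be the set of all metrics $d$ on $X\sqcup X'$ whose restriction to each of the two copies of $X$ is $d_X$ and which satisfy $\inf_{x,y\in X}d(x,y')>0$. Two metrics $b,d$ on a set $Z$ are coarsely equivalent if there are monotone functions $\varphi,\psi:[0,\infty)\to[0,\infty)$ with $\lim_{t\to\infty}\varphi(t)=\lim_{t\to\infty}\psi(t)=\infty$ such that $\varphi(d(z_1,z_2))\le b(z_1,z_2)\le\psi(d(z_1,z_2))$ for all $z_1,z_2\in Z$; $[d]$ denotes the coarse equivalence class of $d$. $M(X)$ is the set of coarse equivalence classes of metrics in $\mathcal M(X)$, with multiplication $[\rho][d]=[\rho\circ d]$, where $\rho\circ d\in\mathcal M(X)$ is determined by $(\rho\circ d)(x,z')=\inf_{y\in X}[d(x,y')+\rho(y,z')]$ for $x,z\in X$. It is known that this is well defined and that $M(X)$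 is an inverse semigroup; the pseudo-inverse of $s=[d]$ is $s^*=[d^*]$ with $d^*(x,y')=d(x',y)$, and the unit $\mathbf 1$ is the class of the metric $d(x,y')=d_X(x,y)+1$. *)

theory Defs
  imports "HOL-Analysis.Analysis"
begin

text \<open>
  Monotone functions from [0,\<open>\<infinity>\<close>) to [0,\<open>\<infinity>\<close>) that tend to infinity; values of the HOL function
  at negative arguments are irrelevant.
\<close>
definition control_function :: "(real \<Rightarrow> real) \<Rightarrow> bool" where
  "control_function \<phi> \<longleftrightarrow>
     \<phi> \<in> {0..} \<rightarrow> {0..} \<and> mono_on {0..} \<phi> \<and> filterlim \<phi> at_top at_top"

definition coarsely_equivalent :: "'z set \<Rightarrow> ('z \<Rightarrow> 'z \<Rightarrow> real) \<Rightarrow> ('z \<Rightarrow> 'z \<Rightarrow> real) \<Rightarrow> bool" where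
  "coarsely_equivalent Z b d \<longleftrightarrow>
     (\<exists>\<phi> \<psi>. control_function \<phi> \<and> control_function \<psi> \<and>
        (\<forall>z\<^sub>1\<in>Z. \<forall>z\<^sub>2\<in>Z. \<phi> (d z\<^sub>1 z\<^sub>2) \<le> b z\<^sub>1 z\<^sub>2 \<and> b z\<^sub>1 z\<^sub>2 \<le> \<psi> (d z\<^sub>1 z\<^sub>2)))"

text \<open>Exchange of the two copies in a double.\<close>
fun flip :: "'a + 'a \<Rightarrow> 'a + 'a" where
  "flip (Inl x) = Inr x"
| "flip (Inr x) = Inl x"

context Metric_space
begin

text \<open>Finiteness is required explicitly because \<^const>\<open>card\<close> is 0 on infinite sets.\<close>
definition bounded_geometry :: bool where
  "bounded_geometry \<longleftrightarrow>
     (\<forall>r>0. \<exists>N. \<forall>x\<in>M. finite (mball x r) \<and> card (mball x r) \<le> N)"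

definition neighborhood :: "real \<Rightarrow> 'a set \<Rightarrow> 'a set" where
  "neighborhood r A = (\<Union>a\<in>A. mball a r)"

text \<open>
  Only meaningful together with bounded geometry, which makes all neighborhoods of finite sets
  finite.
\<close>
definition amenable :: bool where
  "amenable \<longleftrightarrow>
     (\<exists>F :: nat \<Rightarrow> 'a set.
        (\<forall>n. F n \<noteq> {} \<and> finite (F n) \<and> F n \<subseteq> M) \<and>
        (\<forall>r>0. (\<lambda>n. real (card (neighborhood r (F n) - F n)) / real (card (F n)))
                 \<longlonglongrightarrow> 0))"

text \<open>
  The double of the space is the disjoint union \<open>M <+> M\<close>: the point \<open>x\<close> of the first copy is
  \<open>Inl x\<close>, the corresponding point \<open>x'\<close> of the second copy is \<open>Inr x\<close>. The infimum is the
  intended one whenever the space is non-empty.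
\<close>
definition double_metrics :: "('a + 'a \<Rightarrow> 'a + 'a \<Rightarrow> real) set" where
  "double_metrics =
     {\<rho>. Metric_space (M <+> M) \<rho> \<and>
         (\<forall>x\<in>M. \<forall>y\<in>M. \<rho> (Inl x) (Inl y) = d x y \<and> \<rho> (Inr x) (Inr y) = d x y) \<and>
         (INF (x, y)\<in>M \<times> M. \<rho> (Inl x) (Inr y)) > 0}"

definition coarse_rel ::
    "(('a + 'a \<Rightarrow> 'a + 'a \<Rightarrow> real) \<times> ('a + 'a \<Rightarrow> 'a + 'a \<Rightarrow> real)) set" where
  "coarse_rel =
     {(b, \<rho>). b \<in> double_metrics \<and> \<rho> \<in> double_metrics \<and> coarsely_equivalent (M <+> M) b \<rho>}"

definition coarse_class ::
    "('a + 'a \<Rightarrow> 'a + 'a \<Rightarrow> real) \<Rightarrow> ('a + 'a \<Rightarrow> 'a + 'a \<Rightarrow> real) set" where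
  "coarse_class \<rho> = coarse_rel `` {\<rho>}"

text \<open>The underlying set of the inverse semigroup \<open>M(X)\<close>.\<close>
definition double_classes :: "('a + 'a \<Rightarrow> 'a + 'a \<Rightarrow> real) set set" where
  "double_classes = double_metrics // coarse_rel"

text \<open>The symmetric function on the double with values \<open>c x y\<close> at \<open>(x, y')\<close> that extends \<open>d\<close>.\<close>
fun double_extension :: "('a \<Rightarrow> 'a \<Rightarrow> real) \<Rightarrow> 'a + 'a \<Rightarrow> 'a + 'a \<Rightarrow> real" where
  "double_extension c (Inl x) (Inl y) = d x y"
| "double_extension c (Inr x) (Inr y) = d x y"
| "double_extension c (Inl x) (Inr y) = c x y"
| "double_extension c (Inr y) (Inl x) = c x y"

definition metric_comp ::
    "('a + 'a \<Rightarrow> 'a + 'a \<Rightarrow> real) \<Rightarrow> ('a + 'a \<Rightarrow> 'a + 'a \<Rightarrow> real) \<Rightarrow> 'a + 'a \<Rightarrow> 'a + 'a \<Rightarrow> real" where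
  "metric_comp \<rho> \<delta> =
     double_extension (\<lambda>x z. INF y\<in>M. \<delta> (Inl x) (Inr y) + \<rho> (Inl y) (Inr z))"

definition metric_star ::
    "('a + 'a \<Rightarrow> 'a + 'a \<Rightarrow> real) \<Rightarrow> 'a + 'a \<Rightarrow> 'a + 'a \<Rightarrow> real" where
  "metric_star \<delta> p q = \<delta> (flip p) (flip q)"

text \<open>
  The operations on \<open>M(X)\<close> are lifted from representatives in the usual way: they do not depend on
  the representatives, so each of the following unions has a single value.
\<close>
definition class_mult ::
    "('a + 'a \<Rightarrow> 'a + 'a \<Rightarrow> real) set \<Rightarrow> ('a + 'a \<Rightarrow> 'a + 'a \<Rightarrow> real) set \<Rightarrow>
     ('a + 'a \<Rightarrow> 'a + 'a \<Rightarrow> real) set" where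
  "class_mult s t = (\<Union>\<rho>\<in>s. \<Union>\<delta>\<in>t. coarse_class (metric_comp \<rho> \<delta>))"

definition class_star ::
    "('a + 'a \<Rightarrow> 'a + 'a \<Rightarrow> real) set \<Rightarrow> ('a + 'a \<Rightarrow> 'a + 'a \<Rightarrow> real) set" where
  "class_star s = (\<Union>\<delta>\<in>s. coarse_class (metric_star \<delta>))"

definition class_one :: "('a + 'a \<Rightarrow> 'a + 'a \<Rightarrow> real) set" where
  "class_one = coarse_class (double_extension (\<lambda>x y. d x y + 1))"

end

end

theory Submission
  imports Defs
begin

text \<open>
  An almost isometric self-embedding \<open>f\<close> of a metric space gives an element \<open>s\<close> of the inverse
  semigroup by putting \<open>f x\<close> in the second copy at bounded distance from \<open>x\<close> in the first copy.
  For a class \<open>s\<close> of a metric \<open>\<delta>\<close> on the double, \<open>s\<^sup>*s = 1\<close> means precisely that every point of the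
  first copy is within a uniform distance of the second one, and \<open>ss\<^sup>* = 1\<close> is the same condition
  with the copies exchanged; so it suffices that the image of \<open>f\<close> is not coarsely dense.
  Take the natural numbers as the end points of a hedgehog whose \<open>n\<close>-th spine has length
  \<open>log\<^sub>2 (n + 1) + 1\<close>, and \<open>f n = 2 n + 1\<close>. This \<open>f\<close> changes each length by 1, hence distances by at
  most 2, but the even numbers are arbitrarily far from its image. Balls of radius \<open>r\<close> consist of
  their centre and boundedly many short spines, and far away they are singletons,
  so singletons form a Foelner sequence.
\<close>

section \<open>Coarse equivalence\<close>

text \<open>One half of coarse equivalence, freed of control functions: for nonnegative functions,
  this relation in both directions amounts to \<open>coarsely_equivalent\<close>.\<close>

definition controlled_by :: "'z set \<Rightarrow> ('z \<Rightarrow> 'z \<Rightarrow> real) \<Rightarrow> ('z \<Rightarrow> 'z \<Rightarrow> real) \<Rightarrow> bool" where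
  "controlled_by Z b d \<longleftrightarrow> (\<forall>R. \<exists>S. \<forall>z1\<in>Z. \<forall>z2\<in>Z. d z1 z2 \<le> R \<longrightarrow> b z1 z2 \<le> S)"

lemma controlled_by_refl: "controlled_by Z b b"
  by (auto simp: controlled_by_def)

lemma controlled_by_trans:
  "controlled_by Z a b \<Longrightarrow> controlled_by Z b c \<Longrightarrow> controlled_by Z a c"
  unfolding controlled_by_def by meson

lemma coarsely_equivalent_imp_controlled_by:
  assumes "coarsely_equivalent Z b d" "\<And>x y. d x y \<ge> 0"
  shows "controlled_by Z b d" "controlled_by Z d b"
proof -
  obtain \<phi> \<psi> where \<phi>: "control_function \<phi>" and \<psi>: "control_function \<psi>"
    and bd: "\<And>x y. x \<in> Z \<Longrightarrow> y \<in> Z \<Longrightarrow> \<phi> (d x y) \<le> b x y \<and> b x y \<le> \<psi> (d x y)"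
    using assms(1) unfolding coarsely_equivalent_def by blast
  show "controlled_by Z b d"
    unfolding controlled_by_def
  proof (intro allI exI ballI impI)
    fix R x y assume xy: "x \<in> Z" "y \<in> Z" "d x y \<le> R"
    \<comment> \<open>\<open>R\<close> may be negative, where nothing is known about
      \<open>\<psi>\<close>; hence \<open>max 0 R\<close>.\<close>
    have "\<psi> (d x y) \<le> \<psi> (max 0 R)"
      using \<psi> xy assms(2)[of x y] unfolding control_function_def
      by (auto intro!: mono_onD[of "{0..}" \<psi>])
    then show "b x y \<le> \<psi> (max 0 R)"
      using bd[OF xy(1,2)] by linarith
  qed
  show "controlled_by Z d b"
    unfolding controlled_by_def
  proof
    fix R
    have "eventually (\<lambda>t. \<phi> t > R) at_top"
      using \<phi> unfolding control_function_def filterlim_at_top_dense by blast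
    then obtain S where S: "\<And>t. t \<ge> S \<Longrightarrow> \<phi> t > R"
      by (auto simp: eventually_at_top_linorder)
    have "d x y \<le> S" if "x \<in> Z" "y \<in> Z" "b x y \<le> R" for x y
      using S[of "d x y"] bd[OF that(1,2)] that(3) by linarith
    then show "\<exists>S. \<forall>x\<in>Z. \<forall>y\<in>Z. b x y \<le> R \<longrightarrow> d x y \<le> S" by blast
  qed
qed

text \<open>The extremal envelopes serve as control functions: the supremum of \<open>b\<close> over
  pairs with \<open>d \<le> t\<close> is finite by \<open>bd\<close>, and the infimum of
  \<open>b\<close> over pairs with \<open>t \<le> d\<close> tends to infinity by
  \<open>db\<close>.\<close>

lemma controlled_by_imp_coarsely_equivalent:
  assumes bd: "controlled_by Z b d" and db: "controlled_by Z d b"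
    and b0: "\<And>x y. b x y \<ge> 0" and d0: "\<And>x y. d x y \<ge> 0"
  shows "coarsely_equivalent Z b d"
proof -
  \<comment> \<open>The inserted \<open>0\<close> and \<open>t\<close> keep the sets nonempty. With
    \<open>t\<close> in \<open>L t\<close>, \<open>\<phi>\<close> grows even if \<open>d\<close> is
    bounded; the summand \<open>t\<close> makes \<open>\<psi>\<close> grow even if \<open>b\<close>
    is bounded.\<close>
  define U where "U t = insert 0 {b x y | x y. x \<in> Z \<and> y \<in> Z \<and> d x y \<le> t}" for t
  define L where "L t = insert t {b x y | x y. x \<in> Z \<and> y \<in> Z \<and> t \<le> d x y}" for t
  define \<psi> where "\<psi> t = t + Sup (U t)" for t
  define \<phi> where "\<phi> t = Inf (L t)" for t
  have bddU: "bdd_above (U t)" for t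
  proof -
    obtain S where "\<forall>z1\<in>Z. \<forall>z2\<in>Z. d z1 z2 \<le> t \<longrightarrow> b z1 z2 \<le> S"
      using bd unfolding controlled_by_def by blast
    then show ?thesis
      unfolding bdd_above_def by (intro exI[of _ "max 0 S"]) (auto simp: U_def le_max_iff_disj)
  qed
  have L0: "u \<ge> 0" if "u \<in> L t" "t \<ge> 0" for u t
    using that b0 by (auto simp: L_def)
  have bddL: "bdd_below (L t)" if "t \<ge> 0" for t
    using L0[OF _ that] by (rule bdd_belowI)
  have neU: "U t \<noteq> {}" and neL: "L t \<noteq> {}" for t
    by (auto simp: U_def L_def)
  have SupU0: "Sup (U t) \<ge> 0" for t
    by (rule cSup_upper[OF _ bddU]) (simp add: U_def)
  have "control_function \<psi>"
    unfolding control_function_def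
  proof (intro conjI)
    show "\<psi> \<in> {0..} \<rightarrow> {0..}"
      using SupU0 by (auto simp: \<psi>_def)
    show "mono_on {0..} \<psi>"
    proof (rule mono_onI)
      fix s t :: real assume "s \<le> t"
      then have "U s \<subseteq> U t" unfolding U_def by (blast intro: order_trans)
      then show "\<psi> s \<le> \<psi> t"
        unfolding \<psi>_def using \<open>s \<le> t\<close> cSup_subset_mono[OF neU bddU] by (meson add_mono)
    qed
    show "filterlim \<psi> at_top at_top"
      by (rule filterlim_at_top_mono[OF filterlim_ident]) (simp add: \<psi>_def SupU0)
  qed
  moreover have "control_function \<phi>"
    unfolding control_function_def
  proof (intro conjI)
    show "\<phi> \<in> {0..} \<rightarrow> {0..}"
      using L0 by (auto simp: \<phi>_def intro!: cInf_greatest[OF neL])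
    show "mono_on {0..} \<phi>"
    proof (rule mono_onI)
      fix s t :: real assume st: "s \<in> {0..}" "s \<le> t"
      show "\<phi> s \<le> \<phi> t"
        unfolding \<phi>_def
      proof (rule cInf_greatest[OF neL])
        fix u assume "u \<in> L t"
        then consider "u = t" | "u \<in> L s"
          using st(2) unfolding L_def by (blast intro: order_trans)
        then show "Inf (L s) \<le> u"
        proof cases
          case 1
          have "Inf (L s) \<le> s" by (rule cInf_lower) (use st bddL in \<open>auto simp: L_def\<close>)
          then show ?thesis using 1 st(2) by linarith
        next
          case 2
          then show ?thesis by (rule cInf_lower) (use st bddL in auto)
        qed
      qed
    qed
    show "filterlim \<phi> at_top at_top"
      unfolding filterlim_at_top
    proof
      fix K
      obtain S where S: "\<And>x y. x \<in> Z \<Longrightarrow> y \<in> Z \<Longrightarrow> b x y \<le> K \<Longrightarrow> d x y \<le> S"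
        using db unfolding controlled_by_def by blast
      \<comment> \<open>An element of \<open>L t\<close> is \<open>t\<close> itself, which exceeds
        \<open>K\<close>, or a value of \<open>b\<close> at a pair with \<open>d > S\<close>, which
        exceeds \<open>K\<close> by the choice of \<open>S\<close>.\<close>
      have "K \<le> \<phi> t" if "t > max S K" for t
        unfolding \<phi>_def
      proof (rule cInf_greatest[OF neL])
        fix u assume "u \<in> L t"
        then show "K \<le> u" using that S by (force simp: L_def)
      qed
      then show "eventually (\<lambda>t. K \<le> \<phi> t) at_top"
        using eventually_gt_at_top by (rule eventually_mono[rotated])
    qed
  qed
  moreover have "\<phi> (d x y) \<le> b x y" if "x \<in> Z" "y \<in> Z" for x y
    unfolding \<phi>_def using that by (intro cInf_lower bddL d0) (auto simp: L_def)
  moreover have "b x y \<le> \<psi> (d x y)" if "x \<in> Z" "y \<in> Z" for x y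
  proof -
    have "b x y \<le> Sup (U (d x y))"
      using that by (intro cSup_upper bddU) (auto simp: U_def)
    then show ?thesis using d0[of x y] by (simp add: \<psi>_def)
  qed
  ultimately show ?thesis
    unfolding coarsely_equivalent_def by blast
qed

section \<open>The semigroup of metrics on the double\<close>

lemma flip_flip [simp]: "flip (flip p) = p"
  by (cases p) simp_all

context Metric_space
begin

abbreviation cross :: "('a + 'a \<Rightarrow> 'a + 'a \<Rightarrow> real) \<Rightarrow> 'a \<Rightarrow> 'a \<Rightarrow> real" where
  "cross \<rho> x y \<equiv> \<rho> (Inl x) (Inr y)"

lemma double_metricsD:
  assumes "\<rho> \<in> double_metrics"
  shows "Metric_space (M <+> M) \<rho>"
    and "\<And>p q. \<rho> p q \<ge> 0"
    and "\<And>p q. \<rho> p q = \<rho> q p"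
    and "\<And>x y. x \<in> M \<Longrightarrow> y \<in> M \<Longrightarrow> \<rho> (Inl x) (Inl y) = d x y"
    and "\<And>x y. x \<in> M \<Longrightarrow> y \<in> M \<Longrightarrow> \<rho> (Inr x) (Inr y) = d x y"
  using assms by (auto simp: double_metrics_def Metric_space.nonneg Metric_space.commute)

text \<open>These are the triangle inequalities for two points of one copy and one of the other.
  They are also what has to be checked when a metric on the double is built from cross
  distances.\<close>

lemma double_metrics_cross_triangle:
  assumes "\<rho> \<in> double_metrics" "x \<in> M" "y \<in> M" "z \<in> M"
  shows "cross \<rho> x y \<le> d x z + cross \<rho> z y"
    and "cross \<rho> x y \<le> cross \<rho> x z + d z y"
    and "d x z \<le> cross \<rho> x y + cross \<rho> z y"
    and "d y z \<le> cross \<rho> x y + cross \<rho> x z"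
proof -
  note D = double_metricsD[OF assms(1)]
  note T = Metric_space.triangle[OF D(1)]
  show "cross \<rho> x y \<le> d x z + cross \<rho> z y"
    using T[of "Inl x" "Inl z" "Inr y"] assms D(4) by auto
  show "cross \<rho> x y \<le> cross \<rho> x z + d z y"
    using T[of "Inl x" "Inr z" "Inr y"] assms D(5) by auto
  show "d x z \<le> cross \<rho> x y + cross \<rho> z y"
    using T[of "Inl x" "Inr y" "Inl z"] assms D(4) D(3)[of "Inr y" "Inl z"] by auto
  show "d y z \<le> cross \<rho> x y + cross \<rho> x z"
    using T[of "Inr y" "Inl x" "Inr z"] assms D(5) D(3)[of "Inr y" "Inl x"] by auto
qed

lemma double_metrics_cross_bound:
  assumes "\<rho> \<in> double_metrics"
  obtains e where "e > 0" "\<And>x y. x \<in> M \<Longrightarrow> y \<in> M \<Longrightarrow> e \<le> cross \<rho> x y"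
proof (rule that)
  let ?c = "\<lambda>p. cross \<rho> (fst p) (snd p)"
  show "(INF p\<in>M\<times>M. ?c p) > 0"
    using assms by (simp add: double_metrics_def case_prod_unfold)
  have "bdd_below (?c ` (M\<times>M))"
    by (rule bdd_belowI2[where m = 0]) (rule double_metricsD(2)[OF assms])
  then show "(INF p\<in>M\<times>M. ?c p) \<le> cross \<rho> x y" if "x \<in> M" "y \<in> M" for x y
    using cINF_lower[of ?c "M\<times>M" "(x, y)"] that by auto
qed

text \<open>A uniform lower bound replaces the infimum; \<open>M \<noteq> {}\<close> excludes the
  infimum of the empty set, whose value says nothing.\<close>

lemma double_metricsI:
  assumes "Metric_space (M <+> M) \<rho>" "M \<noteq> {}" "e > 0"
    and "\<And>x y. x \<in> M \<Longrightarrow> y \<in> M \<Longrightarrow> \<rho> (Inl x) (Inl y) = d x y"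
    and "\<And>x y. x \<in> M \<Longrightarrow> y \<in> M \<Longrightarrow> \<rho> (Inr x) (Inr y) = d x y"
    and "\<And>x y. x \<in> M \<Longrightarrow> y \<in> M \<Longrightarrow> e \<le> cross \<rho> x y"
  shows "\<rho> \<in> double_metrics"
proof -
  have "e \<le> (INF (x, y)\<in>M\<times>M. cross \<rho> x y)"
    using assms by (intro cINF_greatest) auto
  then show ?thesis
    using assms by (auto simp: double_metrics_def)
qed

text \<open>
  Nonnegativity of \<open>c\<close> is required even off \<open>M\<close>, because a \<^locale>\<open>Metric_space\<close> has a
  nonnegative distance on the whole type.
\<close>
lemma double_extension_in_double_metrics:
  assumes "M \<noteq> {}" "e > 0" and nonneg: "\<And>x y. c x y \<ge> 0"
    and e: "\<And>x y. x \<in> M \<Longrightarrow> y \<in> M \<Longrightarrow> e \<le> c x y"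
    and left: "\<And>x y z. x \<in> M \<Longrightarrow> y \<in> M \<Longrightarrow> z \<in> M \<Longrightarrow> c x y \<le> d x z + c z y"
    and right: "\<And>x y z. x \<in> M \<Longrightarrow> y \<in> M \<Longrightarrow> z \<in> M \<Longrightarrow> c x y \<le> c x z + d z y"
    and "\<And>x y z. x \<in> M \<Longrightarrow> y \<in> M \<Longrightarrow> z \<in> M \<Longrightarrow> d x z \<le> c x y + c z y"
    and "\<And>x y z. x \<in> M \<Longrightarrow> y \<in> M \<Longrightarrow> z \<in> M \<Longrightarrow> d y z \<le> c x y + c x z"
  shows "double_extension c \<in> double_metrics"
proof (rule double_metricsI[OF _ assms(1,2)])
  show "Metric_space (M <+> M) (double_extension c)"
  proof
    fix p q r :: "'a + 'a"
    show "0 \<le> double_extension c p q"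
      using nonneg by (cases p; cases q) auto
    show "double_extension c p q = double_extension c q p"
      by (cases p; cases q) (auto simp: commute)
    show "double_extension c p q = 0 \<longleftrightarrow> p = q" if "p \<in> M <+> M" "q \<in> M <+> M"
      using that \<open>e > 0\<close> by (fastforce dest: e)
    show "double_extension c p r \<le> double_extension c p q + double_extension c q r"
      if "p \<in> M <+> M" "q \<in> M <+> M" "r \<in> M <+> M"
    proof -
      \<comment> \<open>\<open>c\<close> always takes its argument from the first copy first, so
        paths that start in the second copy need these reversed forms.\<close>
      have "c x y \<le> c z y + d z x" "c x y \<le> d y z + c x z" if "x \<in> M" "y \<in> M" "z \<in> M" for x y z
        using left[OF that] right[OF that] by (simp_all add: commute)
      then show ?thesis
        using that assms(5-8) triangle by (elim PlusE) simp_all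
    qed
  qed
qed (use e in auto)

section \<open>Exchange of the two copies\<close>

lemma metric_star_star [simp]: "metric_star (metric_star \<rho>) = \<rho>"
  by (simp add: metric_star_def fun_eq_iff)

lemma cross_metric_star:
  assumes "\<rho> \<in> double_metrics"
  shows "cross (metric_star \<rho>) x y = cross \<rho> y x"
  using double_metricsD(3)[OF assms] by (simp add: metric_star_def)

lemma metric_star_in_double_metrics:
  assumes "\<rho> \<in> double_metrics" "M \<noteq> {}"
  shows "metric_star \<rho> \<in> double_metrics"
proof -
  note D = double_metricsD[OF assms(1)]
  obtain e where e: "e > 0" "\<And>x y. x \<in> M \<Longrightarrow> y \<in> M \<Longrightarrow> e \<le> cross \<rho> x y"
    using double_metrics_cross_bound[OF assms(1)] by blast
  have flip: "flip p \<in> M <+> M" if "p \<in> M <+> M" for p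
    using that by auto
  show ?thesis
  proof (rule double_metricsI[OF _ assms(2) e(1)])
    show "Metric_space (M <+> M) (metric_star \<rho>)"
      unfolding metric_star_def
    proof
      fix p q r
      show "0 \<le> \<rho> (flip p) (flip q)" by (rule D)
      show "\<rho> (flip p) (flip q) = \<rho> (flip q) (flip p)" by (rule D)
      show "\<rho> (flip p) (flip q) = 0 \<longleftrightarrow> p = q" if "p \<in> M <+> M" "q \<in> M <+> M"
        using Metric_space.zero[OF D(1) flip flip] that flip_flip by metis
      show "\<rho> (flip p) (flip r) \<le> \<rho> (flip p) (flip q) + \<rho> (flip q) (flip r)"
        if "p \<in> M <+> M" "q \<in> M <+> M" "r \<in> M <+> M"
        by (rule Metric_space.triangle[OF D(1)]) (use that flip in blast)+
    qed
    show "e \<le> cross (metric_star \<rho>) x y" if "x \<in> M" "y \<in> M" for x y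
      using e(2) that by (simp add: cross_metric_star[OF assms(1)])
  qed (use D(4,5) in \<open>auto simp: metric_star_def\<close>)
qed

section \<open>Composition of metrics on the double\<close>

lemma cross_metric_comp_le:
  assumes "\<rho> \<in> double_metrics" "\<delta> \<in> double_metrics" "y \<in> M"
  shows "cross (metric_comp \<rho> \<delta>) x z \<le> cross \<delta> x y + cross \<rho> y z"
  using assms double_metricsD(2)
  by (auto simp: metric_comp_def intro!: cINF_lower bdd_belowI2[where m = 0])

lemma cross_metric_comp_ge:
  assumes "M \<noteq> {}" "\<And>y. y \<in> M \<Longrightarrow> u \<le> cross \<delta> x y + cross \<rho> y z"
  shows "u \<le> cross (metric_comp \<rho> \<delta>) x z"
  using assms by (auto simp: metric_comp_def intro!: cINF_greatest)

text \<open>The infimum need not be attained, so an intermediate point is available only below a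
  strict upper bound. This is where the slack 1 in later estimates comes from.\<close>

lemma cross_metric_comp_approx:
  assumes "M \<noteq> {}" "cross (metric_comp \<rho> \<delta>) x z < u"
  obtains y where "y \<in> M" "cross \<delta> x y + cross \<rho> y z < u"
  using cross_metric_comp_ge[of u \<delta> x \<rho> z] assms by (meson not_le)

lemma metric_comp_in_double_metrics:
  assumes \<rho>: "\<rho> \<in> double_metrics" and \<delta>: "\<delta> \<in> double_metrics" and ne: "M \<noteq> {}"
  shows "metric_comp \<rho> \<delta> \<in> double_metrics"
proof -
  let ?c = "cross (metric_comp \<rho> \<delta>)"
  note le = cross_metric_comp_le[OF \<rho> \<delta>]
  note ge = cross_metric_comp_ge[OF ne]
  note T\<rho> = double_metrics_cross_triangle[OF \<rho>] and T\<delta> = double_metrics_cross_triangle[OF \<delta>]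
  note D\<rho> = double_metricsD[OF \<rho>] and D\<delta> = double_metricsD[OF \<delta>]
  obtain e where e: "e > 0" "\<And>x y. x \<in> M \<Longrightarrow> y \<in> M \<Longrightarrow> e \<le> cross \<rho> x y"
    using double_metrics_cross_bound[OF \<rho>] by blast
  have "double_extension ?c \<in> double_metrics"
  proof (rule double_extension_in_double_metrics[OF ne e(1)])
    show "0 \<le> ?c x y" for x y
      by (intro ge add_nonneg_nonneg D\<rho> D\<delta>)
    fix x y assume xy: "x \<in> M" "y \<in> M"
    show "e \<le> ?c x y"
      using e(2) xy D\<delta>(2) by (intro ge) (simp add: add_increasing)
    fix z assume z: "z \<in> M"
    have "?c x y - d x z \<le> ?c z y"
    proof (rule ge)
      fix w assume w: "w \<in> M"
      show "?c x y - d x z \<le> cross \<delta> z w + cross \<rho> w y"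
        using le[OF w, of x y] T\<delta>(1)[OF xy(1) w z] by linarith
    qed
    then show "?c x y \<le> d x z + ?c z y" by linarith
    have "?c x y - d z y \<le> ?c x z"
    proof (rule ge)
      fix w assume w: "w \<in> M"
      show "?c x y - d z y \<le> cross \<delta> x w + cross \<rho> w z"
        using le[OF w, of x y] T\<rho>(2)[OF w xy(2) z] by linarith
    qed
    then show "?c x y \<le> ?c x z + d z y" by linarith
    \<comment> \<open>Both infima are opened in turn, with intermediate points \<open>v\<close> and
      \<open>w\<close>. Both are joined to \<open>y\<close> by \<open>\<rho>\<close>, which bounds
      \<open>d w v\<close> and allows \<open>w\<close> to be replaced by \<open>v\<close>.\<close>
    have "d x z - ?c x y \<le> ?c z y"
    proof (rule ge)
      fix v assume v: "v \<in> M"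
      have "d x z - (cross \<delta> z v + cross \<rho> v y) \<le> ?c x y"
      proof (rule ge)
        fix w assume w: "w \<in> M"
        show "d x z - (cross \<delta> z v + cross \<rho> v y) \<le> cross \<delta> x w + cross \<rho> w y"
          using T\<delta>(3)[OF xy(1) v z] T\<delta>(2)[OF xy(1) v w] T\<rho>(3)[OF w xy(2) v] by linarith
      qed
      then show "d x z - ?c x y \<le> cross \<delta> z v + cross \<rho> v y" by linarith
    qed
    then show "d x z \<le> ?c x y + ?c z y" by linarith
    \<comment> \<open>The mirror image: now \<open>d w v\<close> is bounded by
      \<open>\<delta>\<close> through the common point \<open>x\<close>.\<close>
    have "d y z - ?c x y \<le> ?c x z"
    proof (rule ge)
      fix v assume v: "v \<in> M"
      have "d y z - (cross \<delta> x v + cross \<rho> v z) \<le> ?c x y"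
      proof (rule ge)
        fix w assume w: "w \<in> M"
        show "d y z - (cross \<delta> x v + cross \<rho> v z) \<le> cross \<delta> x w + cross \<rho> w y"
          using T\<rho>(4)[OF w xy(2) z] T\<rho>(1)[OF w z v] T\<delta>(4)[OF xy(1) w v] by linarith
      qed
      then show "d y z - ?c x y \<le> cross \<delta> x v + cross \<rho> v z" by linarith
    qed
    then show "d y z \<le> ?c x y + ?c x z" by linarith
  qed
  then show ?thesis by (simp add: metric_comp_def)
qed

section \<open>Coarse equivalence in terms of cross distances\<close>

lemma controlled_by_double_iff:
  assumes "b \<in> double_metrics" "\<rho> \<in> double_metrics"
  shows "controlled_by (M <+> M) b \<rho> \<longleftrightarrow> controlled_by M (cross b) (cross \<rho>)"
proof
  assume "controlled_by (M <+> M) b \<rho>"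
  then show "controlled_by M (cross b) (cross \<rho>)"
    unfolding controlled_by_def by (meson InlI InrI)
next
  assume L: "controlled_by M (cross b) (cross \<rho>)"
  note Db = double_metricsD[OF assms(1)] and D\<rho> = double_metricsD[OF assms(2)]
  show "controlled_by (M <+> M) b \<rho>"
    unfolding controlled_by_def
  proof
    fix R
    obtain S where S: "\<And>x y. x \<in> M \<Longrightarrow> y \<in> M \<Longrightarrow> cross \<rho> x y \<le> R \<Longrightarrow> cross b x y \<le> S"
      using L unfolding controlled_by_def by blast
    \<comment> \<open>Inside one copy both metrics equal \<open>d\<close>, so the bound
      \<open>R\<close> carries over; across the copies \<open>S\<close> applies.\<close>
    have "b p q \<le> max R S" if "p \<in> M <+> M" "q \<in> M <+> M" "\<rho> p q \<le> R" for p q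
      using that S Db(4,5) D\<rho>(4,5) Db(3)[of "Inr _" "Inl _"] D\<rho>(3)[of "Inr _" "Inl _"]
      by (elim PlusE) (simp_all add: le_max_iff_disj)
    then show "\<exists>S. \<forall>p\<in>M <+> M. \<forall>q\<in>M <+> M. \<rho> p q \<le> R \<longrightarrow> b p q \<le> S"
      by blast
  qed
qed

lemma coarse_rel_iff:
  "(b, \<rho>) \<in> coarse_rel \<longleftrightarrow> b \<in> double_metrics \<and> \<rho> \<in> double_metrics \<and>
     controlled_by M (cross b) (cross \<rho>) \<and> controlled_by M (cross \<rho>) (cross b)"
proof -
  have "coarsely_equivalent (M <+> M) b \<rho> \<longleftrightarrow>
      controlled_by (M <+> M) b \<rho> \<and> controlled_by (M <+> M) \<rho> b"
    if "b \<in> double_metrics" "\<rho> \<in> double_metrics"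
    using coarsely_equivalent_imp_controlled_by controlled_by_imp_coarsely_equivalent
      double_metricsD(2)[OF that(1)] double_metricsD(2)[OF that(2)] by blast
  then show ?thesis
    using controlled_by_double_iff by (auto simp: coarse_rel_def)
qed

lemma equiv_coarse_rel: "equiv double_metrics coarse_rel"
proof (rule equivI)
  show "coarse_rel \<subseteq> double_metrics \<times> double_metrics"
    by (auto simp: coarse_rel_iff)
  show "refl_on double_metrics coarse_rel"
    by (auto simp: refl_on_def coarse_rel_iff controlled_by_refl)
  show "sym coarse_rel"
    by (auto simp: sym_def coarse_rel_iff)
  show "trans coarse_rel"
    unfolding trans_def coarse_rel_iff using controlled_by_trans by blast
qed

lemma coarse_class_eq_iff:
  assumes "b \<in> double_metrics" "\<rho> \<in> double_metrics"
  shows "coarse_class b = coarse_class \<rho> \<longleftrightarrow> (b, \<rho>) \<in> coarse_rel"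
  using eq_equiv_class_iff[OF equiv_coarse_rel assms] by (simp add: coarse_class_def)

section \<open>Descent of the operations to coarse classes\<close>

lemma metric_star_coarse_rel:
  assumes "(\<rho>, \<rho>') \<in> coarse_rel" "M \<noteq> {}"
  shows "(metric_star \<rho>, metric_star \<rho>') \<in> coarse_rel"
proof -
  have \<rho>: "\<rho> \<in> double_metrics" "\<rho>' \<in> double_metrics"
    using assms(1) by (auto simp: coarse_rel_iff)
  show ?thesis
    using assms(1) metric_star_in_double_metrics[OF \<rho>(1) assms(2)]
      metric_star_in_double_metrics[OF \<rho>(2) assms(2)]
    unfolding coarse_rel_iff controlled_by_def cross_metric_star[OF \<rho>(1)] cross_metric_star[OF \<rho>(2)]
    by meson
qed

text \<open>On a path within 1 of the infimum, each leg is shorter than \<open>R + 1\<close> by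
  nonnegativity of the other; the two hypotheses bound the legs separately, along the same
  intermediate point.\<close>

lemma metric_comp_controlled_by:
  assumes "\<rho> \<in> double_metrics" "\<delta> \<in> double_metrics" "\<rho>' \<in> double_metrics" "\<delta>' \<in> double_metrics"
    and ne: "M \<noteq> {}"
    and "controlled_by M (cross \<rho>') (cross \<rho>)" "controlled_by M (cross \<delta>') (cross \<delta>)"
  shows "controlled_by M (cross (metric_comp \<rho>' \<delta>')) (cross (metric_comp \<rho> \<delta>))"
  unfolding controlled_by_def
proof
  fix R
  obtain S where
    S: "\<And>x y. x \<in> M \<Longrightarrow> y \<in> M \<Longrightarrow> cross \<rho> x y \<le> R + 1 \<Longrightarrow> cross \<rho>' x y \<le> S"
    using assms(6) unfolding controlled_by_def by blast
  obtain T where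
    T: "\<And>x y. x \<in> M \<Longrightarrow> y \<in> M \<Longrightarrow> cross \<delta> x y \<le> R + 1 \<Longrightarrow> cross \<delta>' x y \<le> T"
    using assms(7) unfolding controlled_by_def by blast
  have "cross (metric_comp \<rho>' \<delta>') x z \<le> T + S"
    if xz: "x \<in> M" "z \<in> M" "cross (metric_comp \<rho> \<delta>) x z \<le> R" for x z
  proof -
    obtain y where y: "y \<in> M" "cross \<delta> x y + cross \<rho> y z < R + 1"
      using cross_metric_comp_approx[OF ne, of \<rho> \<delta> x z "R + 1"] xz(3) by auto
    have "cross \<delta>' x y \<le> T" "cross \<rho>' y z \<le> S"
      using S T y xz double_metricsD(2)[OF assms(1), of "Inl y" "Inr z"]
        double_metricsD(2)[OF assms(2), of "Inl x" "Inr y"] by auto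
    then show ?thesis
      using cross_metric_comp_le[OF assms(3,4) y(1), of x z] by linarith
  qed
  then show "\<exists>S. \<forall>x\<in>M. \<forall>z\<in>M.
      cross (metric_comp \<rho> \<delta>) x z \<le> R \<longrightarrow> cross (metric_comp \<rho>' \<delta>') x z \<le> S"
    by blast
qed

lemma metric_comp_coarse_rel:
  assumes "(\<rho>, \<rho>') \<in> coarse_rel" "(\<delta>, \<delta>') \<in> coarse_rel" "M \<noteq> {}"
  shows "(metric_comp \<rho> \<delta>, metric_comp \<rho>' \<delta>') \<in> coarse_rel"
  using assms metric_comp_in_double_metrics metric_comp_controlled_by
  by (auto simp: coarse_rel_iff)

text \<open>The union runs over a nonempty family of equal classes, as the class of the star does
  not depend on the representative.\<close>

lemma class_star_coarse_class:
  assumes "\<delta> \<in> double_metrics" "M \<noteq> {}"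
  shows "class_star (coarse_class \<delta>) = coarse_class (metric_star \<delta>)"
proof -
  have "coarse_class (metric_star \<delta>') = coarse_class (metric_star \<delta>)" if "\<delta>' \<in> coarse_class \<delta>" for \<delta>'
    using metric_star_coarse_rel[OF _ assms(2)] that equiv_class_eq[OF equiv_coarse_rel]
    by (fastforce simp: coarse_class_def)
  moreover have "\<delta> \<in> coarse_class \<delta>"
    using equiv_class_self[OF equiv_coarse_rel assms(1)] by (simp add: coarse_class_def)
  ultimately show ?thesis
    unfolding class_star_def by blast
qed

lemma class_mult_coarse_class:
  assumes "\<rho> \<in> double_metrics" "\<delta> \<in> double_metrics" "M \<noteq> {}"
  shows "class_mult (coarse_class \<rho>) (coarse_class \<delta>) = coarse_class (metric_comp \<rho> \<delta>)"
proof -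
  have "coarse_class (metric_comp \<rho>' \<delta>') = coarse_class (metric_comp \<rho> \<delta>)"
    if "\<rho>' \<in> coarse_class \<rho>" "\<delta>' \<in> coarse_class \<delta>" for \<rho>' \<delta>'
    using metric_comp_coarse_rel[OF _ _ assms(3)] that equiv_class_eq[OF equiv_coarse_rel]
    by (fastforce simp: coarse_class_def)
  moreover have "\<rho> \<in> coarse_class \<rho>" "\<delta> \<in> coarse_class \<delta>"
    using equiv_class_self[OF equiv_coarse_rel] assms by (auto simp: coarse_class_def)
  ultimately show ?thesis
    unfolding class_mult_def by blast
qed

text \<open>The composition has cross distance
  \<open>INF y. cross \<delta> x y + cross \<delta> z y\<close> from \<open>x\<close> to
  \<open>z\<close>. On the diagonal this is twice the distance from \<open>x\<close> to the second
  copy, and leaving the diagonal costs at most \<open>d x z\<close>.\<close>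

lemma class_star_mult_eq_one_iff:
  assumes \<delta>: "\<delta> \<in> double_metrics" and ne: "M \<noteq> {}"
  shows "class_mult (class_star (coarse_class \<delta>)) (coarse_class \<delta>) = class_one \<longleftrightarrow>
    (\<exists>C. \<forall>x\<in>M. \<exists>y\<in>M. cross \<delta> x y \<le> C)"
proof -
  let ?p = "metric_comp (metric_star \<delta>) \<delta>" and ?one = "double_extension (\<lambda>x y. d x y + 1)"
  note \<delta>' = metric_star_in_double_metrics[OF \<delta> ne]
  have p: "?p \<in> double_metrics"
    by (rule metric_comp_in_double_metrics[OF \<delta>' \<delta> ne])
  have one: "?one \<in> double_metrics"
    by (rule double_extension_in_double_metrics[OF ne zero_less_one])
      (auto simp: nonneg triangle commute intro: order_trans[OF triangle])
  \<comment> \<open>This lower estimate holds for every \<open>\<delta>\<close>, so one of the two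
    control relations is automatic and only the other is a condition.\<close>
  have ge: "d x z \<le> cross ?p x z" if "x \<in> M" "z \<in> M" for x z
    using double_metrics_cross_triangle(3)[OF \<delta>] that
    by (auto intro!: cross_metric_comp_ge[OF ne] simp: cross_metric_star[OF \<delta>])
  have "controlled_by M (cross ?one) (cross ?p)"
    unfolding controlled_by_def
  proof (intro allI exI ballI impI)
    fix R x z assume "x \<in> M" "z \<in> M" "cross ?p x z \<le> R"
    then show "cross ?one x z \<le> R + 1" using ge[of x z] by simp
  qed
  moreover have "controlled_by M (cross ?p) (cross ?one) \<longleftrightarrow> (\<exists>C. \<forall>x\<in>M. \<exists>y\<in>M. cross \<delta> x y \<le> C)"
  proof
    assume "controlled_by M (cross ?p) (cross ?one)"
    \<comment> \<open>The bound 1 is the distance from \<open>x\<close> to its own copy in the unit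
      metric.\<close>
    then obtain S where S: "\<And>x z. x \<in> M \<Longrightarrow> z \<in> M \<Longrightarrow> cross ?one x z \<le> 1 \<Longrightarrow> cross ?p x z \<le> S"
      unfolding controlled_by_def by blast
    have "\<exists>y\<in>M. cross \<delta> x y \<le> S + 1" if x: "x \<in> M" for x
    proof -
      have "cross ?p x x < S + 1" using S[OF x x] x by simp
      then obtain y where "y \<in> M" "cross \<delta> x y + cross \<delta> x y < S + 1"
        using cross_metric_comp_approx[OF ne] cross_metric_star[OF \<delta>] by metis
      then show ?thesis
        using double_metricsD(2)[OF \<delta>, of "Inl x" "Inr y"] by (intro bexI[of _ y]) linarith+
    qed
    then show "\<exists>C. \<forall>x\<in>M. \<exists>y\<in>M. cross \<delta> x y \<le> C" by blast
  next
    assume "\<exists>C. \<forall>x\<in>M. \<exists>y\<in>M. cross \<delta> x y \<le> C"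
    then obtain C where C: "\<And>x. x \<in> M \<Longrightarrow> \<exists>y\<in>M. cross \<delta> x y \<le> C" by blast
    show "controlled_by M (cross ?p) (cross ?one)"
      unfolding controlled_by_def
    proof (intro allI exI ballI impI)
      fix R x z assume xz: "x \<in> M" "z \<in> M" "cross ?one x z \<le> R"
      obtain y where y: "y \<in> M" "cross \<delta> x y \<le> C" using C[OF xz(1)] by blast
      \<comment> \<open>The path goes through a point \<open>y\<close> near \<open>x\<close>; its
        leg to \<open>z\<close> is at most \<open>C + d x z\<close>.\<close>
      show "cross ?p x z \<le> 2 * C + R"
        using cross_metric_comp_le[OF \<delta>' \<delta> y(1), of x z] y(2) xz(3)
          double_metrics_cross_triangle(1)[OF \<delta> xz(2) y(1) xz(1)]
        by (simp add: cross_metric_star[OF \<delta>] commute)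
    qed
  qed
  ultimately show ?thesis
    unfolding class_star_coarse_class[OF \<delta> ne] class_mult_coarse_class[OF \<delta>' \<delta> ne] class_one_def
      coarse_class_eq_iff[OF p one] coarse_rel_iff
    using p one by blast
qed

text \<open>The previous criterion for the starred metric: starring twice is the identity, and cross
  distances are transposed.\<close>

corollary class_mult_star_eq_one_iff:
  assumes \<delta>: "\<delta> \<in> double_metrics" and ne: "M \<noteq> {}"
  shows "class_mult (coarse_class \<delta>) (class_star (coarse_class \<delta>)) = class_one \<longleftrightarrow>
    (\<exists>C. \<forall>y\<in>M. \<exists>x\<in>M. cross \<delta> x y \<le> C)"
  using class_star_mult_eq_one_iff[OF metric_star_in_double_metrics[OF \<delta> ne] ne]
    class_star_coarse_class[OF \<delta> ne]
    class_star_coarse_class[OF metric_star_in_double_metrics[OF \<delta> ne] ne]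
  by (simp add: cross_metric_star[OF \<delta>])

end

section \<open>A logarithmic hedgehog\<close>

text \<open>Base 2 makes doubling an additive shift by 1; the summand 1 keeps even spine 0 at
  positive length.\<close>

definition spine :: "nat \<Rightarrow> real" where
  "spine n = log 2 (real n + 1) + 1"

definition hedgehog_dist :: "nat \<Rightarrow> nat \<Rightarrow> real" where
  "hedgehog_dist m n = (if m = n then 0 else spine m + spine n)"

text \<open>Tip \<open>m\<close> of the first copy is joined to tip \<open>2 * m + 1\<close> of the
  second at distance 1; all other pairs, including equal indices, are joined through a common
  centre.\<close>

definition spine_doubling :: "nat \<Rightarrow> nat \<Rightarrow> real" where
  "spine_doubling m n = (if n = 2 * m + 1 then 1 else spine m + spine n)"

lemma spine_ge_1: "spine n \<ge> 1"
  by (simp add: spine_def)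

text \<open>\<open>(2 * n + 1) + 1\<close> is twice \<open>n + 1\<close>; this is why the embedding
  is \<open>2 * n + 1\<close> and not \<open>2 * n\<close>.\<close>

lemma spine_double: "spine (2 * n + 1) = spine n + 1"
proof -
  have "log 2 (2 * (real n + 1)) = 1 + log 2 (real n + 1)"
    by (subst log_mult) auto
  then show ?thesis by (simp add: spine_def algebra_simps)
qed

lemma finite_short_spines: "finite {n. spine n < r}"
proof (rule finite_subset)
  show "{n. spine n < r} \<subseteq> {..nat \<lceil>2 powr (r - 1)\<rceil>}"
  proof
    fix n assume "n \<in> {n. spine n < r}"
    then have "real n + 1 < 2 powr (r - 1)"
      by (simp add: spine_def less_powr_iff)
    then show "n \<in> {..nat \<lceil>2 powr (r - 1)\<rceil>}" by (simp add: le_nat_iff) linarith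
  qed
qed simp

interpretation hedgehog: Metric_space UNIV hedgehog_dist
proof
  fix x y z
  show "0 \<le> hedgehog_dist x y" "hedgehog_dist x y = 0 \<longleftrightarrow> x = y"
    using spine_ge_1[of x] spine_ge_1[of y] by (auto simp: hedgehog_dist_def)
  show "hedgehog_dist x y = hedgehog_dist y x"
    by (simp add: hedgehog_dist_def)
  show "hedgehog_dist x z \<le> hedgehog_dist x y + hedgehog_dist y z"
    using spine_ge_1[of y] spine_ge_1[of z] by (simp add: hedgehog_dist_def)
qed

text \<open>Reaching another tip costs its whole spine, so apart from the centre all balls of radius
  \<open>r\<close> lie in one and the same finite set.\<close>

lemma hedgehog_mball_subset: "hedgehog.mball x r \<subseteq> insert x {n. spine n < r}"
proof
  fix y assume "y \<in> hedgehog.mball x r"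
  then show "y \<in> insert x {n. spine n < r}"
    using spine_ge_1[of x] by (auto simp: hedgehog_dist_def split: if_splits)
qed

section \<open>Bounded geometry and amenability of the hedgehog\<close>

lemma hedgehog_bounded_geometry: "hedgehog.bounded_geometry"
  unfolding hedgehog.bounded_geometry_def
proof (intro allI impI exI ballI conjI)
  fix r :: real and x :: nat
  have fin: "finite (insert x {n. spine n < r})"
    by (simp add: finite_short_spines)
  show "finite (hedgehog.mball x r)"
    using finite_subset[OF hedgehog_mball_subset fin] .
  show "card (hedgehog.mball x r) \<le> Suc (card {n. spine n < r})"
    using card_mono[OF fin hedgehog_mball_subset]
    by (auto simp: card_insert_if finite_short_spines split: if_splits)
qed

lemma hedgehog_amenable: "hedgehog.amenable"
  unfolding hedgehog.amenable_def
proof (intro exI[of _ "\<lambda>n. {n}"] conjI allI impI)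
  fix r :: real
  \<comment> \<open>Once spine \<open>n\<close> has length at least \<open>r\<close>, no other tip
    is within \<open>r\<close> of \<open>n\<close>, so the Foelner quotient is eventually exactly
    0.\<close>
  have "eventually (\<lambda>n. n \<notin> {n. spine n < r}) sequentially"
    using finite_short_spines eventually_cofinite[of "\<lambda>n. n \<notin> {n. spine n < r}"]
    by (simp add: cofinite_eq_sequentially)
  then have "eventually (\<lambda>n. real (card (hedgehog.neighborhood r {n} - {n})) / real (card {n}) = 0)
      sequentially"
  proof eventually_elim
    case (elim n)
    have "m = n" if "m \<in> hedgehog.neighborhood r {n}" for m
      using that elim spine_ge_1[of m]
      by (auto simp: hedgehog.neighborhood_def hedgehog_dist_def split: if_splits)
    then have "hedgehog.neighborhood r {n} - {n} = {}" by blast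
    then show ?case by (simp only: card.empty)
  qed
  then show "(\<lambda>n. real (card (hedgehog.neighborhood r {n} - {n})) / real (card {n})) \<longlonglongrightarrow> 0"
    by (rule tendsto_eventually)
qed auto

text \<open>A cross distance of 1 makes up for the difference 1 between spines \<open>n\<close> and
  \<open>2 * n + 1\<close>. If both cross distances on the right are 1, injectivity of
  \<open>n \<mapsto> 2 * n + 1\<close> makes the left side 0.\<close>

lemma spine_doubling_in_double_metrics:
  "hedgehog.double_extension spine_doubling \<in> hedgehog.double_metrics"
proof (rule hedgehog.double_extension_in_double_metrics[where e = 1])
  fix x y z
  note h = spine_ge_1[of x] spine_ge_1[of y] spine_ge_1[of z]
    spine_double[of x] spine_double[of z]
  show "1 \<le> spine_doubling x y" "0 \<le> spine_doubling x y"
    using h by (auto simp: spine_doubling_def)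
  show "spine_doubling x y \<le> hedgehog_dist x z + spine_doubling z y"
    using h by (auto simp: spine_doubling_def hedgehog_dist_def)
  show "spine_doubling x y \<le> spine_doubling x z + hedgehog_dist z y"
    using h by (auto simp: spine_doubling_def hedgehog_dist_def)
  show "hedgehog_dist x z \<le> spine_doubling x y + spine_doubling z y"
    using h by (auto simp: spine_doubling_def hedgehog_dist_def)
  show "hedgehog_dist y z \<le> spine_doubling x y + spine_doubling x z"
    using h by (auto simp: spine_doubling_def hedgehog_dist_def)
qed auto

text \<open>An even tip of the second copy is reached only through the centre, at a cost above its
  spine length, and these lengths are unbounded.\<close>

lemma spine_doubling_not_coarsely_onto: "\<not> (\<exists>C. \<forall>y. \<exists>x. spine_doubling x y \<le> C)"
proof
  assume "\<exists>C. \<forall>y. \<exists>x. spine_doubling x y \<le> C"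
  then obtain C where C: "\<And>y. \<exists>x. spine_doubling x y \<le> C" by blast
  have "spine (2 * n) < C" for n
  proof -
    obtain x where "spine_doubling x (2 * n) \<le> C" using C by blast
    moreover have "2 * n \<noteq> 2 * x + 1" by presburger
    ultimately show ?thesis using spine_ge_1[of x] by (simp add: spine_doubling_def)
  qed
  then have "range (\<lambda>n. 2 * n) \<subseteq> {n. spine n < C}" by auto
  moreover have "infinite (range (\<lambda>n::nat. 2 * n))"
    by (rule range_inj_infinite) (simp add: inj_on_def)
  ultimately show False
    using finite_short_spines finite_subset by blast
qed

theorem theorem2p2:
  shows "\<exists>(X :: nat set) (d :: nat \<Rightarrow> nat \<Rightarrow> real).
           Metric_space X d \<and>
           Metric_space.bounded_geometry X d \<and>
           Metric_space.amenable X d \<and>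
           (\<exists>s \<in> Metric_space.double_classes X d.
              Metric_space.class_mult X d (Metric_space.class_star X d s) s
                = Metric_space.class_one X d \<and>
              Metric_space.class_mult X d s (Metric_space.class_star X d s)
                \<noteq> Metric_space.class_one X d)"
proof (intro exI conjI)
  show "Metric_space UNIV hedgehog_dist"
    by (rule hedgehog.Metric_space_axioms)
  show "hedgehog.bounded_geometry" by (rule hedgehog_bounded_geometry)
  show "hedgehog.amenable" by (rule hedgehog_amenable)
  let ?\<delta> = "hedgehog.double_extension spine_doubling"
  let ?s = "hedgehog.coarse_class ?\<delta>"
  show "\<exists>s \<in> hedgehog.double_classes.
      hedgehog.class_mult (hedgehog.class_star s) s = hedgehog.class_one \<and>
      hedgehog.class_mult s (hedgehog.class_star s) \<noteq> hedgehog.class_one"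
  proof (intro bexI[of _ ?s] conjI)
    \<comment> \<open>Each tip of the first copy has its partner at distance 1, so
      \<open>C = 1\<close> meets the criterion for \<open>s\<^sup>*s = 1\<close>.\<close>
    have "\<exists>y. spine_doubling x y \<le> 1" for x
      by (rule exI[of _ "2 * x + 1"]) (simp add: spine_doubling_def)
    then show "hedgehog.class_mult (hedgehog.class_star ?s) ?s = hedgehog.class_one"
      using hedgehog.class_star_mult_eq_one_iff[OF spine_doubling_in_double_metrics] by auto
    show "hedgehog.class_mult ?s (hedgehog.class_star ?s) \<noteq> hedgehog.class_one"
      using hedgehog.class_mult_star_eq_one_iff[OF spine_doubling_in_double_metrics]
        spine_doubling_not_coarsely_onto by auto
    show "?s \<in> hedgehog.double_classes"
      unfolding hedgehog.double_classes_def hedgehog.coarse_class_def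
      by (rule quotientI) (rule spine_doubling_in_double_metrics)
  qed
qed

end
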